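(* Let $F$ be an integrable (complex-valued) function on the unit circle in the complex plane, and let $$G(x) = \int_0^\infty e^{itx} F(e^{it})\, dt$$ when $\operatorname{Im} x > 0$. Then for every $t \in (0, \pi)$ such that $F$ is continuous at $e^{it}$ we have $$F(e^{it}) = \lim_{n \to \infty} \frac{(-1)^n\, (x_n)^{\overline{n+1}}}{i\, n!}\, \Delta^n G(x_n), \qquad ( * )$$ where $\Delta$ is the forward difference operator and $$x_n = \frac{n}{2}\Bigl(i \cot\frac{t}{2} - 1\Bigr).$$ The same result holds true in the more general case when, instead of integrability of $F$, we assume that $(e^{it} - 1)^n F(e^{it})$ is integrable over $(0, 2\pi)$ for sufficiently large $n$, provided that in $( * )$ we agree that $$\Delta^n G(x) = \int_0^\infty e^{itx} (e^{it} - 1)^n F(e^{it})\, dt$$ for $n$ large enough.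
   Context: The forward difference operator is $\Delta G(x) = G(x+1) - G(x)$, and $\Delta^n$ is its $n$th iterate. The rising factorial is $x^{\overline{n}} = x(x+1)\cdots(x+n-1)$, so $x^{\overline{n+1}} = x(x+1)\cdots(x+n)$. Here $i$ is the imaginary unit. *)

theory Defs
  imports "HOL-Analysis.Analysis"
begin

definition forward_diff :: "(complex \<Rightarrow> complex) \<Rightarrow> complex \<Rightarrow> complex" where
  "forward_diff G = (\<lambda>x. G (x + 1) - G x)"

text \<open>Integrability with respect to arc length. Only the values of \<open>F\<close> on the unit circle
  are used, and integrability is in the sense of Lebesgue.\<close>

definition circle_integrable :: "(complex \<Rightarrow> complex) \<Rightarrow> bool" where
  "circle_integrable F \<longleftrightarrow> set_integrable lebesgue {0..2*pi} (\<lambda>s. F (cis s))"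

text \<open>The function \<open>G\<close>. It is meaningful for \<open>Im x > 0\<close> only; the iterated differences of \<open>G\<close>
  at a point of the upper half-plane involve no other values.\<close>

definition G_transform :: "(complex \<Rightarrow> complex) \<Rightarrow> complex \<Rightarrow> complex" where
  "G_transform F x = (LINT s:{0..}|lebesgue. exp (\<i> * of_real s * x) * F (cis s))"

text \<open>The integral that stands for the \<open>n\<close>-th forward difference of \<open>G\<close> at \<open>x\<close> when \<open>F\<close> itself
  need not be integrable, so that \<open>G\<close> need not exist. It is meaningful for \<open>Im x > 0\<close> and
  \<open>n\<close> sufficiently large.\<close>

definition generalized_diff :: "(complex \<Rightarrow> complex) \<Rightarrow> nat \<Rightarrow> complex \<Rightarrow> complex" where
  "generalized_diff F n x =
     (LINT s:{0..}|lebesgue. exp (\<i> * of_real s * x) * (cis s - 1) ^ n * F (cis s))"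

definition node :: "real \<Rightarrow> nat \<Rightarrow> complex" where
  "node t n = of_nat n / 2 * (\<i> * of_real (cot (t / 2)) - 1)"

end

theory Submission
  imports Defs
begin

text \<open>
  For \<open>x = x\<^sub>n\<close> the kernel \<open>e\<^bsup>isx\<^esup> (e\<^bsup>is\<^esup> - 1)\<^bsup>n\<^esup>\<close> of \<open>\<Delta>\<^bsup>n\<^esup> G(x)\<close> is \<open>(2i)\<^bsup>n\<^esup> \<phi>(s)\<^bsup>n\<^esup>\<close> with
  \<open>\<phi>(s) = sin(s/2) e\<^bsup>-cs/2\<^esup>\<close>, \<open>c = cot(t/2)\<close>, and \<open>t\<close> is the only maximum of \<open>\<phi> \<ge> 0\<close> on
  \<open>[0, 2\<pi>]\<close>. A shift by \<open>2\<pi>\<close> multiplies the integrand by a constant of modulus less than \<open>1\<close>, so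
  the integral over the half-line is the one over a period up to a factor that does not depend on
  \<open>F\<close>. For \<open>F = 1\<close> we have \<open>G(x) = i/x\<close>, whose differences are explicit: the prefactor is exactly
  the normalisation that turns the integral into the average of \<open>F\<close> with weight
  \<open>\<phi>\<^bsup>n\<^esup>\<close>. As \<open>n\<close> grows, these averages concentrate at \<open>t\<close>.
\<close>

section \<open>Integrals of quasiperiodic functions over the half-line\<close>

text \<open>The translates of one period tile the half-line, and on the \<open>k\<close>-th tile
  \<open>f\<close> is \<open>r ^ k\<close> times a shifted copy of its values on the first. Summing
  over the tiles gives a geometric series.\<close>

lemma integral_halfline_quasiperiodic:
  fixes f :: "real \<Rightarrow> complex"
  assumes P: "P > 0" and r: "norm r < 1"
    and per: "\<And>s. f (s + P) = r * f s"
    and int: "set_integrable lebesgue {0<..<P} f"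
  shows "set_integrable lebesgue {0..} f"
    and "(LINT s:{0..}|lebesgue. f s) = (LINT s:{0<..<P}|lebesgue. f s) / (1 - r)"
proof -
  define g where "g s = indicator {0..<P} s *\<^sub>R f s" for s
  \<comment> \<open>\<open>h k\<close> is \<open>f\<close> cut off to the \<open>k\<close>-th tile;
    the factor \<open>1\<close> gives the argument the shape of an affine substitution.\<close>
  define h where "h k s = r ^ k * g (- (real k * P) + 1 * s)" for k :: nat and s
  \<comment> \<open>Adding the null set \<open>{0}\<close> makes the tiles half-open, so that their
    translates cover the half-line without overlap.\<close>
  have "set_integrable lebesgue {0..<P} f \<longleftrightarrow> set_integrable lebesgue {0<..<P} f"
    by (rule set_integrable_discrete_difference[where X="{0}"]) auto
  then have g_int: "integrable lebesgue g"
    using int by (simp add: set_integrable_def g_def[abs_def])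
  have "(LINT s:{0..<P}|lebesgue. f s) = (LINT s:{0<..<P}|lebesgue. f s)"
    by (rule set_integral_discrete_difference[where X="{0}"]) auto
  then have g_eq: "integral\<^sup>L lebesgue g = (LINT s:{0<..<P}|lebesgue. f s)"
    by (simp add: set_lebesgue_integral_def g_def[abs_def])
  have shift: "f (s + real k * P) = r ^ k * f s" for s k
  proof (induction k)
    case (Suc k)
    have "f (s + real (Suc k) * P) = f ((s + real k * P) + P)"
      by (simp add: algebra_simps)
    with Suc per show ?case by simp
  qed simp
  have h_eq: "h k s = indicator {real k * P..<real (Suc k) * P} s *\<^sub>R f s" for k s
    using shift[of "s - real k * P" k]
    by (auto simp: h_def g_def indicator_def algebra_simps)
  have h_int: "integrable lebesgue (h k)" for k
    unfolding h_def[abs_def]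
    by (intro integrable_mult_right lebesgue_integrable_real_affine g_int) simp
  \<comment> \<open>At each point at most one \<open>h k\<close> is nonzero, so pointwise
    summability is trivial; only the series of the integrals of the norms needs
    \<open>norm r < 1\<close>.\<close>
  have single: "h k s = (if k = nat \<lfloor>s / P\<rfloor> then indicator {0..} s *\<^sub>R f s else 0)" for k s
  proof -
    have "s \<in> {real k * P..<real (Suc k) * P} \<longleftrightarrow> s \<ge> 0 \<and> k = nat \<lfloor>s / P\<rfloor>"
    proof -
      have "s \<in> {real k * P..<real (Suc k) * P} \<longleftrightarrow> real k \<le> s / P \<and> s / P < real k + 1"
        using P by (auto simp: field_simps)
      also have "\<dots> \<longleftrightarrow> \<lfloor>s / P\<rfloor> = int k"
        by (simp add: floor_eq_iff)
      also have "\<dots> \<longleftrightarrow> s \<ge> 0 \<and> k = nat \<lfloor>s / P\<rfloor>"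
      proof -
        have "\<lfloor>s / P\<rfloor> \<ge> 0 \<longleftrightarrow> s \<ge> 0"
          using P by (simp add: zero_le_divide_iff)
        then show ?thesis by (metis nat_int int_nat_eq of_nat_0_le_iff)
      qed
      finally show ?thesis .
    qed
    then show ?thesis
      by (auto simp: h_eq indicator_def)
  qed
  have h_sums: "(\<lambda>k. h k s) sums (indicator {0..} s *\<^sub>R f s)" for s
    unfolding single by (rule sums_single)
  have h_sum: "(\<Sum>k. h k s) = indicator {0..} s *\<^sub>R f s" for s
    using h_sums by (simp add: sums_iff)
  have pointwise: "AE s in lebesgue. summable (\<lambda>k. norm (h k s))"
    by (rule AE_I2, rule summable_finite[where N="{nat \<lfloor>s / P\<rfloor>}" for s])
       (auto simp: single)
  have norm_eq: "(LINT s|lebesgue. norm (h k s)) = norm r ^ k * (LINT s|lebesgue. norm (g s))" for k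
    using lebesgue_integral_real_affine[of 1 "\<lambda>s. norm (g s)" "- (real k * P)"]
    by (simp add: h_def norm_mult norm_power)
  have norms: "summable (\<lambda>k. LINT s|lebesgue. norm (h k s))"
    unfolding norm_eq using r by (intro summable_mult2 summable_geometric) simp
  show "set_integrable lebesgue {0..} f"
    using integrable_suminf[OF h_int pointwise norms]
    by (simp add: h_sum set_integrable_def)
  have int_eq: "integral\<^sup>L lebesgue (h k) = r ^ k * integral\<^sup>L lebesgue g" for k
    using lebesgue_integral_real_affine[of 1 g "- (real k * P)"]
    by (simp add: h_def[abs_def])
  have "(\<lambda>k. integral\<^sup>L lebesgue (h k)) sums (LINT s:{0..}|lebesgue. f s)"
    using sums_integral[OF h_int pointwise norms]
    by (simp add: h_sum set_lebesgue_integral_def)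
  moreover have "(\<lambda>k. integral\<^sup>L lebesgue (h k)) sums (1 / (1 - r) * integral\<^sup>L lebesgue g)"
    unfolding int_eq by (intro sums_mult2 geometric_sums r)
  ultimately show "(LINT s:{0..}|lebesgue. f s) = (LINT s:{0<..<P}|lebesgue. f s) / (1 - r)"
    by (simp add: sums_unique2 g_eq)
qed

section \<open>Concentration of averages weighted by high powers\<close>

text \<open>Laplace's method: away from the maximum point, \<open>\<phi> s ^ n\<close> is
  exponentially smaller than the total mass. Since \<open>g\<close> itself may fail to be integrable
  where \<open>\<phi>\<close> vanishes, a fixed power of \<open>\<phi>\<close> has to stay attached
  to it in the estimates.\<close>

lemma power_weighted_average_tendsto:
  fixes \<phi> :: "real \<Rightarrow> real" and g :: "real \<Rightarrow> complex"
  assumes t: "a < t" "t < b"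
    and cont: "continuous_on {a..b} \<phi>"
    and nonneg: "\<And>s. s \<in> {a..b} \<Longrightarrow> 0 \<le> \<phi> s"
    and max: "\<And>s. s \<in> {a..b} \<Longrightarrow> s \<noteq> t \<Longrightarrow> \<phi> s < \<phi> t"
    and g: "isCont g t"
    and int: "\<forall>\<^sub>F n in sequentially.
      set_integrable lebesgue {a<..<b} (\<lambda>s. complex_of_real (\<phi> s ^ n) * g s)"
  shows "(\<lambda>n. (LINT s:{a<..<b}|lebesgue. complex_of_real (\<phi> s ^ n) * g s)
      / complex_of_real (LINT s:{a<..<b}|lebesgue. \<phi> s ^ n)) \<longlonglongrightarrow> g t"
proof -
  let ?A = "{a<..<b}"
  define h where "h s = g s - g t" for s
  define D where "D n = (LINT s:?A|lebesgue. \<phi> s ^ n)" for n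
  define H where "H n = (LINT s:?A|lebesgue. \<phi> s ^ n * norm (h s))" for n
  obtain N where N: "\<And>n. n \<ge> N \<Longrightarrow> set_integrable lebesgue ?A (\<lambda>s. of_real (\<phi> s ^ n) * g s)"
    using int by (auto simp: eventually_sequentially)
  have pow_int: "set_integrable lebesgue ?A (\<lambda>s. \<phi> s ^ n)" for n
    by (rule set_integrable_subset[of _ "{a..b}"])
       (auto intro!: absolutely_integrable_continuous_real continuous_intros cont)
  have cpow_int: "set_integrable lebesgue ?A (\<lambda>s. complex_of_real (\<phi> s ^ n))" for n
    by (rule set_integrable_subset[of _ "{a..b}"])
       (auto intro!: absolutely_integrable_continuous_real continuous_intros cont)
  have h_int: "set_integrable lebesgue ?A (\<lambda>s. of_real (\<phi> s ^ n) * h s)" if "n \<ge> N" for n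
    unfolding h_def right_diff_distrib
    by (intro set_integral_diff N that set_integrable_mult_left cpow_int)
  have norm_eq: "norm (of_real (\<phi> s ^ n) * h s) = \<phi> s ^ n * norm (h s)" if "s \<in> ?A" for s n
    using nonneg[of s] that by (simp add: norm_mult norm_power)
  have H_int: "set_integrable lebesgue ?A (\<lambda>s. \<phi> s ^ n * norm (h s))" if "n \<ge> N" for n
    using set_integrable_norm[OF h_int[OF that]]
    by (rule set_integrable_cong[THEN iffD1, rotated -1]) (use norm_eq in auto)
  \<comment> \<open>The mass decays no faster than any geometric rate below \<open>\<phi> t\<close>:
    by continuity \<open>\<phi> > \<rho>\<close> on an interval of length \<open>2 * d\<close> about
    \<open>t\<close>, and that length serves as \<open>\<delta>\<close>.\<close>
  have Dlow: "\<exists>\<delta>>0. \<forall>n. D n \<ge> \<delta> * \<rho> ^ n" if \<rho>: "0 \<le> \<rho>" "\<rho> < \<phi> t" for \<rho>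
  proof -
    have "isCont \<phi> t"
      using cont t by (simp add: continuous_on_interior)
    then have "\<forall>\<^sub>F s in at t. \<rho> < \<phi> s"
      using \<rho> by (intro order_tendstoD(1)) (auto simp: isCont_def)
    moreover have "\<forall>\<^sub>F s in at t. s \<in> ?A"
      using t by (intro eventually_at_in_open') auto
    ultimately have "\<forall>\<^sub>F s in at t. \<rho> < \<phi> s \<and> s \<in> ?A"
      by eventually_elim auto
    then obtain d where d: "d > 0" "\<And>s. s \<noteq> t \<Longrightarrow> dist s t < d \<Longrightarrow> \<rho> < \<phi> s \<and> s \<in> ?A"
      by (auto simp: eventually_at)
    have d': "\<rho> < \<phi> s \<and> s \<in> ?A" if "s \<in> {t-d<..<t+d}" for s
      using d(2)[of s] that \<rho> t by (cases "s = t") (auto simp: dist_real_def)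
    let ?V = "{t-d<..<t+d}"
    have "D n \<ge> (2 * d) * \<rho> ^ n" for n
    proof -
      have "(2 * d) * \<rho> ^ n = (LINT s:?V|lebesgue. \<rho> ^ n)"
        using \<open>d > 0\<close> by (subst set_integral_const) auto
      also have "\<dots> = (LINT s:?A|lebesgue. indicator ?V s * \<rho> ^ n)"
        unfolding set_lebesgue_integral_def
        by (rule Bochner_Integration.integral_cong) (use d' in \<open>auto simp: indicator_def\<close>)
      also have "\<dots> \<le> D n"
        unfolding D_def
      proof (rule set_integral_mono)
        show "set_integrable lebesgue ?A (\<lambda>s. indicator ?V s * \<rho> ^ n)"
          unfolding set_integrable_def
          by (rule Bochner_Integration.integrable_cong[THEN iffD1, rotated -1, OF
                integrable_mult_left[OF integrable_real_indicator[of ?V lebesgue], of "\<rho> ^ n"]])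
             (use d' \<open>d > 0\<close> in \<open>auto simp: indicator_def\<close>)
        show "indicator ?V s * \<rho> ^ n \<le> \<phi> s ^ n" if "s \<in> ?A" for s
          using d'[of s] that nonneg[of s] \<rho> by (auto simp: indicator_def intro!: power_mono)
      qed (rule pow_int)
      finally show ?thesis .
    qed
    with \<open>d > 0\<close> show ?thesis by (intro exI[of _ "2 * d"]) auto
  qed
  have \<phi>t: "\<phi> t > 0"
    using max[of a] nonneg[of a] t by auto
  have D_pos: "D n > 0" for n
  proof -
    obtain \<delta> where "\<delta> > 0" "D n \<ge> \<delta> * (\<phi> t / 2) ^ n"
      using Dlow[of "\<phi> t / 2"] \<phi>t by auto
    moreover have "\<delta> * (\<phi> t / 2) ^ n > 0"
      using \<open>\<delta> > 0\<close> \<phi>t by simp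
    ultimately show ?thesis by linarith
  qed
  have H_nonneg: "H n \<ge> 0" for n
    unfolding H_def set_lebesgue_integral_def
    by (rule integral_nonneg_AE) (auto simp: indicator_def intro!: AE_I2 mult_nonneg_nonneg zero_le_power nonneg)
  \<comment> \<open>\<open>H n / D n\<close> is the weighted average of
    \<open>norm (g s - g t)\<close>, which dominates the error of the average of
    \<open>g\<close>.\<close>
  have lim0: "(\<lambda>n. H n / D n) \<longlonglongrightarrow> 0"
  proof (rule order_tendstoI)
    show "\<forall>\<^sub>F n in sequentially. e < H n / D n" if "e < 0" for e
      using that H_nonneg D_pos
      by (intro always_eventually allI) (meson divide_nonneg_pos less_le_trans)
    fix e :: real assume "e > 0"
    then obtain d0 where d0: "d0 > 0" "\<And>s. dist s t < d0 \<Longrightarrow> norm (h s) < e / 2"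
      using g half_gt_zero[of e] unfolding continuous_at_eps_delta h_def dist_norm by blast
    \<comment> \<open>The cap \<open>t - a\<close> keeps \<open>a\<close> outside the ball, so the
      compact complement is nonempty and \<open>\<phi>\<close> attains a maximum there.\<close>
    define d where "d = min d0 (t - a)"
    have "a \<in> {a..b} - ball t d"
      using t by (auto simp: d_def dist_real_def)
    then have "compact ({a..b} - ball t d)" "{a..b} - ball t d \<noteq> {}"
      by (auto intro: compact_diff)
    then obtain u where u: "u \<in> {a..b}" "u \<notin> ball t d"
        "\<And>s. s \<in> {a..b} - ball t d \<Longrightarrow> \<phi> s \<le> \<phi> u"
      using continuous_attains_sup[of "{a..b} - ball t d" \<phi>] continuous_on_subset[OF cont]
      by (metis Diff_iff Diff_subset)
    \<comment> \<open>\<open>\<rho>\<close> bounds \<open>\<phi>\<close> off the ball. The midpoint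
      \<open>\<rho>'\<close> leaves room on both sides: \<open>\<rho>' < \<phi> t\<close> gives the
      lower bound for \<open>D\<close>, and \<open>\<rho> < \<rho>'\<close> makes the quotient
      decay.\<close>
    define \<rho> \<rho>' where "\<rho> = \<phi> u" and "\<rho>' = (\<phi> u + \<phi> t) / 2"
    have "u \<noteq> t"
      using u(2) d0 t by (auto simp: d_def)
    then have \<rho>: "0 \<le> \<rho>" "\<rho> < \<rho>'" "\<rho>' < \<phi> t"
      using nonneg[OF u(1)] max[OF u(1)] by (auto simp: \<rho>_def \<rho>'_def)
    obtain \<delta> where \<delta>: "\<delta> > 0" "\<And>n. D n \<ge> \<delta> * \<rho>' ^ n"
      using Dlow[of \<rho>'] \<rho> by auto
    \<comment> \<open>Inside the ball \<open>norm (h s)\<close> is at most \<open>e / 2\<close>.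
      Outside, only \<open>k\<close> of the \<open>N + k\<close> factors are estimated by
      \<open>\<rho>\<close>; the other \<open>N\<close> keep the integral finite, equal to at most
      \<open>H N\<close>.\<close>
    have bound: "H (N + k) / D (N + k) \<le> e / 2 + (\<rho> / \<rho>') ^ k * (H N / (\<delta> * \<rho>' ^ N))" for k
    proof -
      have "H (N + k) \<le> (LINT s:?A|lebesgue. e / 2 * \<phi> s ^ (N + k) + \<rho> ^ k * (\<phi> s ^ N * norm (h s)))"
        unfolding H_def
      proof (rule set_integral_mono)
        show "set_integrable lebesgue ?A (\<lambda>s. \<phi> s ^ (N + k) * norm (h s))"
          by (rule H_int) simp
        show "set_integrable lebesgue ?A
            (\<lambda>s. e / 2 * \<phi> s ^ (N + k) + \<rho> ^ k * (\<phi> s ^ N * norm (h s)))"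
          by (intro set_integral_add set_integrable_mult_right pow_int H_int order_refl)
        fix s assume s: "s \<in> ?A"
        then have nn: "0 \<le> \<phi> s" by (intro nonneg) auto
        show "\<phi> s ^ (N + k) * norm (h s)
            \<le> e / 2 * \<phi> s ^ (N + k) + \<rho> ^ k * (\<phi> s ^ N * norm (h s))"
        proof (cases "s \<in> ball t d")
          case True
          then have "norm (h s) \<le> e / 2"
            using d0(2)[of s] by (auto simp: d_def dist_commute)
          then have "\<phi> s ^ (N + k) * norm (h s) \<le> \<phi> s ^ (N + k) * (e / 2)"
            using nn by (intro mult_left_mono) auto
          moreover have "0 \<le> \<rho> ^ k * (\<phi> s ^ N * norm (h s))"
            using nn \<rho> by simp
          ultimately show ?thesis by (simp add: mult.commute)
        next
          case False
          then have "\<phi> s \<le> \<rho>"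
            using u(3)[of s] s by (auto simp: \<rho>_def)
          then have "\<phi> s ^ k * (\<phi> s ^ N * norm (h s)) \<le> \<rho> ^ k * (\<phi> s ^ N * norm (h s))"
            using nn by (intro mult_right_mono power_mono) auto
          moreover have "0 \<le> e / 2 * \<phi> s ^ (N + k)"
            using nn \<open>e > 0\<close> by simp
          ultimately show ?thesis by (simp add: power_add mult_ac)
        qed
      qed
      also have "\<dots> = e / 2 * D (N + k) + \<rho> ^ k * H N"
        unfolding D_def H_def
        by (subst set_integral_add(2))
           (auto intro!: set_integrable_mult_right pow_int H_int simp del: set_integrable_mult_right_iff)
      finally have "H (N + k) / D (N + k) \<le> e / 2 + \<rho> ^ k * H N / D (N + k)"
        using D_pos[of "N + k"] by (simp add: field_simps)
      also have "\<rho> ^ k * H N / D (N + k) \<le> \<rho> ^ k * H N / (\<delta> * \<rho>' ^ (N + k))"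
        using \<delta> \<rho> H_nonneg[of N] by (intro divide_left_mono mult_pos_pos D_pos mult_nonneg_nonneg) auto
      also have "\<dots> = (\<rho> / \<rho>') ^ k * (H N / (\<delta> * \<rho>' ^ N))"
        by (simp add: power_add power_divide)
      finally show ?thesis by simp
    qed
    have "(\<lambda>k. e / 2 + (\<rho> / \<rho>') ^ k * (H N / (\<delta> * \<rho>' ^ N))) \<longlonglongrightarrow> e / 2 + 0 * (H N / (\<delta> * \<rho>' ^ N))"
      using \<rho> by (intro tendsto_intros LIMSEQ_power_zero) auto
    then have "\<forall>\<^sub>F k in sequentially. e / 2 + (\<rho> / \<rho>') ^ k * (H N / (\<delta> * \<rho>' ^ N)) < e"
      by (rule order_tendstoD(2)) (use \<open>e > 0\<close> in auto)
    then have "\<forall>\<^sub>F k in sequentially. H (k + N) / D (k + N) < e"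
      by eventually_elim (use bound in \<open>auto simp: add.commute intro: le_less_trans\<close>)
    then show "\<forall>\<^sub>F n in sequentially. H n / D n < e"
      by (subst (asm) eventually_sequentially_seg)
  qed
  have "(\<lambda>n. (LINT s:?A|lebesgue. of_real (\<phi> s ^ n) * g s) / of_real (D n) - g t) \<longlonglongrightarrow> 0"
  proof (rule Lim_null_comparison[OF _ lim0])
    show "\<forall>\<^sub>F n in sequentially.
        norm ((LINT s:?A|lebesgue. of_real (\<phi> s ^ n) * g s) / of_real (D n) - g t) \<le> H n / D n"
      using eventually_ge_at_top[of N]
    proof eventually_elim
      case (elim n)
      have "(LINT s:?A|lebesgue. of_real (\<phi> s ^ n) * h s)
          = (LINT s:?A|lebesgue. of_real (\<phi> s ^ n) * g s) - (LINT s:?A|lebesgue. of_real (\<phi> s ^ n) * g t)"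
        unfolding h_def right_diff_distrib
        by (intro set_integral_diff N elim set_integrable_mult_left cpow_int)
      also have "(LINT s:?A|lebesgue. of_real (\<phi> s ^ n) * g t) = of_real (D n) * g t"
        by (simp add: D_def set_integral_complex_of_real[symmetric])
      finally have "(LINT s:?A|lebesgue. of_real (\<phi> s ^ n) * g s) / of_real (D n) - g t
          = (LINT s:?A|lebesgue. of_real (\<phi> s ^ n) * h s) / of_real (D n)"
        using D_pos[of n] by (simp add: field_simps)
      also have "norm \<dots> = norm (LINT s:?A|lebesgue. of_real (\<phi> s ^ n) * h s) / D n"
        using D_pos[of n] by (simp add: norm_divide)
      also have "norm (LINT s:?A|lebesgue. of_real (\<phi> s ^ n) * h s)
          \<le> (LINT s:?A|lebesgue. norm (of_real (\<phi> s ^ n) * h s))"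
        by (intro set_integral_norm_bound h_int elim)
      also have "\<dots> = H n"
        unfolding H_def by (rule set_lebesgue_integral_cong) (use norm_eq in \<open>auto simp del: of_real_power\<close>)
      finally show ?case
        using D_pos[of n] by (simp add: divide_right_mono)
    qed
  qed
  then show ?thesis
    by (subst (asm) LIM_zero_iff) (simp add: D_def)
qed

section \<open>The weight and the kernel at the nodes\<close>

text \<open>The derivative is a positive factor times \<open>sin ((t - s) / 2)\<close>: the
  coefficient \<open>cot (t / 2)\<close> is what puts the critical point at \<open>t\<close>. On the
  interval, \<open>(t - s) / 2\<close> stays strictly between \<open>-pi\<close> and
  \<open>pi\<close> wherever the derivative is needed, so its sign is that of
  \<open>t - s\<close>.\<close>

lemma sin_exp_less_max:
  fixes s t :: real
  assumes t: "0 < t" "t < pi" and s: "0 \<le> s" "s \<le> 2 * pi" "s \<noteq> t"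
  shows "sin (s / 2) * exp (- (cot (t / 2) * s / 2)) < sin (t / 2) * exp (- (cot (t / 2) * t / 2))"
proof -
  define f where "f s = sin (s / 2) * exp (- (cot (t / 2) * s / 2))" for s
  define f' where "f' s = exp (- (cot (t / 2) * s / 2)) / (2 * sin (t / 2)) * sin ((t - s) / 2)" for s
  have st: "sin (t / 2) > 0"
    using t by (intro sin_gt_zero) auto
  have deriv: "(f has_real_derivative f' x) (at x)" for x
  proof -
    have "(f has_real_derivative
        exp (- (cot (t / 2) * x / 2)) / 2 * (cos (x / 2) - cot (t / 2) * sin (x / 2))) (at x)"
      unfolding f_def[abs_def] by (auto intro!: derivative_eq_intros simp: algebra_simps)
    also have "cos (x / 2) - cot (t / 2) * sin (x / 2) = sin ((t - x) / 2) / sin (t / 2)"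
    proof -
      have "sin ((t - x) / 2) = sin (t / 2) * cos (x / 2) - cos (t / 2) * sin (x / 2)"
        by (simp add: diff_divide_distrib sin_diff)
      then show ?thesis using st by (simp add: cot_def diff_divide_distrib)
    qed
    finally show ?thesis by (simp add: f'_def)
  qed
  have cont: "continuous_on S f" for S
    using deriv by (meson DERIV_isCont continuous_at_imp_continuous_on)
  have "f s < f t"
  proof (cases "s < t")
    case True
    then show ?thesis
    proof (rule DERIV_pos_imp_increasing_open[OF _ _ cont])
      fix x assume "s < x" "x < t"
      then have "sin ((t - x) / 2) > 0"
        using t s by (intro sin_gt_zero) auto
      then show "\<exists>y. (f has_real_derivative y) (at x) \<and> 0 < y"
        using deriv[of x] st by (intro exI[of _ "f' x"]) (auto simp: f'_def)
    qed
  next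
    case False
    with s have "t < s" by simp
    then show ?thesis
    proof (rule DERIV_neg_imp_decreasing_open[OF _ _ cont])
      fix x assume "t < x" "x < s"
      then have "sin ((x - t) / 2) > 0"
        using t s by (intro sin_gt_zero) auto
      moreover have "sin ((t - x) / 2) = - sin ((x - t) / 2)"
        by (simp flip: sin_minus add: minus_divide_left)
      ultimately show "\<exists>y. (f has_real_derivative y) (at x) \<and> y < 0"
        using deriv[of x] st by (intro exI[of _ "f' x"]) (auto simp: f'_def)
    qed
  qed
  then show ?thesis by (simp add: f_def)
qed

lemma cis_minus_one: "cis s - 1 = 2 * \<i> * of_real (sin (s / 2)) * cis (s / 2)"
proof -
  have "cis s - 1 = (cis (s / 2) - cis (- (s / 2))) * cis (s / 2)"
    by (simp add: left_diff_distrib cis_mult)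
  also have "cis (s / 2) - cis (- (s / 2)) = 2 * \<i> * of_real (sin (s / 2))"
    by (simp add: complex_eq_iff)
  finally show ?thesis .
qed

text \<open>The real part \<open>-n/2\<close> of the node cancels the phase
  \<open>cis (s / 2) ^ n\<close> of \<open>(cis s - 1) ^ n\<close>, and the imaginary part supplies
  the exponential damping. What remains is a constant times the \<open>n\<close>-th power of a real
  function.\<close>

lemma node_kernel:
  "exp (\<i> * of_real s * node t n) * (cis s - 1) ^ n
     = (2 * \<i>) ^ n * of_real ((sin (s / 2) * exp (- (cot (t / 2) * s / 2))) ^ n)"
proof -
  have "\<i> * of_real s * node t n
      = of_nat n * (of_real (- (cot (t / 2) * s / 2)) + - (\<i> * of_real (s / 2)))"
    by (simp add: node_def field_simps)
  then have "exp (\<i> * of_real s * node t n)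
      = (of_real (exp (- (cot (t / 2) * s / 2))) * cis (- (s / 2))) ^ n"
    by (simp only: exp_of_nat_mult exp_add exp_of_real cis_conv_exp) simp
  moreover have "of_real e * cis (- (s / 2)) * (2 * \<i> * of_real (sin (s / 2)) * cis (s / 2))
      = 2 * \<i> * of_real (sin (s / 2) * e)" for e
  proof -
    have "cis (- (s / 2)) * cis (s / 2) = 1"
      by (simp add: cis_mult)
    then show ?thesis by (simp add: mult_ac)
  qed
  ultimately show ?thesis
    by (simp only: cis_minus_one power_mult_distrib[symmetric] of_real_power)
qed

lemma Im_node_pos:
  assumes "0 < t" "t < pi" "n > 0"
  shows "Im (node t n) > 0"
proof -
  have "cot (t / 2) > 0"
    using assms by (intro cot_gt_zero) auto
  then show ?thesis using assms by (simp add: node_def)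
qed

section \<open>Reduction to one period and iterated differences\<close>

text \<open>A shift by \<open>2 * pi\<close> leaves \<open>cis s\<close> alone and multiplies the
  exponential by \<open>exp (2 * pi * \<i> * x)\<close>, of modulus below 1 in the upper half-plane.
  Only the full product is assumed integrable, which also serves the case of non-integrable
  \<open>F\<close>.\<close>

lemma
  fixes F :: "complex \<Rightarrow> complex"
  assumes x: "Im x > 0"
    and int: "set_integrable lebesgue {0<..<2*pi} (\<lambda>s. exp (\<i> * of_real s * x) * (cis s - 1) ^ n * F (cis s))"
  shows generalized_diff_integrable:
      "set_integrable lebesgue {0..} (\<lambda>s. exp (\<i> * of_real s * x) * (cis s - 1) ^ n * F (cis s))"
    and generalized_diff_eq_period:
      "generalized_diff F n x
        = (LINT s:{0<..<2*pi}|lebesgue. exp (\<i> * of_real s * x) * (cis s - 1) ^ n * F (cis s))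
          / (1 - exp (2 * pi * \<i> * x))"
proof -
  have r: "norm (exp (2 * pi * \<i> * x)) < 1"
    using x by simp
  have cis_per: "cis (s + 2 * pi) = cis s" for s
    by (simp add: complex_eq_iff)
  have per: "exp (\<i> * of_real (s + 2 * pi) * x) * (cis (s + 2 * pi) - 1) ^ n * F (cis (s + 2 * pi))
      = exp (2 * pi * \<i> * x) * (exp (\<i> * of_real s * x) * (cis s - 1) ^ n * F (cis s))" for s
    unfolding cis_per by (simp add: exp_add algebra_simps)
  show "set_integrable lebesgue {0..} (\<lambda>s. exp (\<i> * of_real s * x) * (cis s - 1) ^ n * F (cis s))"
    by (rule integral_halfline_quasiperiodic(1)[OF _ r per int]) simp
  show "generalized_diff F n x
      = (LINT s:{0<..<2*pi}|lebesgue. exp (\<i> * of_real s * x) * (cis s - 1) ^ n * F (cis s))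
        / (1 - exp (2 * pi * \<i> * x))"
    unfolding generalized_diff_def
    by (rule integral_halfline_quasiperiodic(2)[OF _ r per int]) simp
qed

lemma set_integrable_mult_continuous:
  fixes f g :: "real \<Rightarrow> complex"
  assumes f: "continuous_on {a..b} f" and g: "set_integrable lebesgue {a..b} g"
  shows "set_integrable lebesgue {a<..<b} (\<lambda>s. f s * g s)"
proof (rule set_integrable_subset[of _ "{a..b}"])
  have meas: "f \<in> borel_measurable (lebesgue_on {a..b})"
    by (intro continuous_imp_measurable_on_sets_lebesgue f) auto
  have "bounded (f ` {a..b})"
    by (intro compact_imp_bounded compact_continuous_image f) auto
  from absolutely_integrable_bounded_measurable_product[OF bilinear_times meas _ this g]
  show "set_integrable lebesgue {a..b} (\<lambda>s. f s * g s)"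
    by simp
qed auto

lemma circle_integrable_kernel:
  assumes "circle_integrable F"
  shows "set_integrable lebesgue {0<..<2*pi} (\<lambda>s. exp (\<i> * of_real s * x) * (cis s - 1) ^ n * F (cis s))"
  using assms unfolding circle_integrable_def
  by (intro set_integrable_mult_continuous continuous_intros)

lemma forward_diff_funpow_Suc:
  "(forward_diff ^^ Suc n) G x = (forward_diff ^^ n) G (x + 1) - (forward_diff ^^ n) G x"
  by (simp add: forward_diff_def)

text \<open>Replacing \<open>x\<close> by \<open>x + 1\<close> multiplies the exponential by
  \<open>cis s\<close>, so each difference contributes one factor \<open>cis s - 1\<close>.
  Integrability of \<open>F\<close> lets the two integrals be subtracted under one integral
  sign.\<close>

lemma iterated_diff_G_transform:
  assumes F: "circle_integrable F" and x: "Im x > 0"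
  shows "(forward_diff ^^ n) (G_transform F) x = generalized_diff F n x"
  using x
proof (induction n arbitrary: x)
  case 0
  then show ?case by (simp add: G_transform_def generalized_diff_def)
next
  case (Suc n)
  have int: "set_integrable lebesgue {0..}
      (\<lambda>s. exp (\<i> * of_real s * y) * (cis s - 1) ^ n * F (cis s))" if "Im y > 0" for y
    by (intro generalized_diff_integrable circle_integrable_kernel F that)
  have "(forward_diff ^^ Suc n) (G_transform F) x
      = generalized_diff F n (x + 1) - generalized_diff F n x"
    using Suc.IH[of "x + 1"] Suc.IH[of x] Suc.prems by (simp add: forward_diff_funpow_Suc del: funpow.simps)
  also have "\<dots> = (LINT s:{0..}|lebesgue. exp (\<i> * of_real s * (x + 1)) * (cis s - 1) ^ n * F (cis s)
      - exp (\<i> * of_real s * x) * (cis s - 1) ^ n * F (cis s))"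
    unfolding generalized_diff_def
    by (rule set_integral_diff(2)[symmetric]) (use int Suc.prems in auto)
  also have "\<dots> = generalized_diff F (Suc n) x"
    unfolding generalized_diff_def
    by (rule arg_cong[where f = "set_lebesgue_integral lebesgue {0..}"], rule ext)
       (simp add: cis_conv_exp exp_add algebra_simps)
  finally show ?case .
qed

section \<open>The constant function and the normalisation\<close>

lemma circle_integrable_one: "circle_integrable (\<lambda>_. 1)"
  unfolding circle_integrable_def by (intro absolutely_integrable_continuous_real continuous_intros)

text \<open>Over one period the antiderivative \<open>exp (\<i> * s * x) / (\<i> * x)\<close>
  produces the factor \<open>exp (2 * pi * \<i> * x) - 1\<close>, which cancels the denominator
  coming from the geometric series.\<close>

lemma G_transform_one:
  assumes x: "Im x > 0"
  shows "G_transform (\<lambda>_. 1) x = \<i> / x"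
proof -
  have x0: "x \<noteq> 0" using x by auto
  have E: "exp (2 * pi * \<i> * x) \<noteq> 1"
  proof
    assume "exp (2 * pi * \<i> * x) = 1"
    then have "norm (exp (2 * pi * \<i> * x)) = 1" by simp
    then show False using x by simp
  qed
  have "G_transform (\<lambda>_. 1) x = generalized_diff (\<lambda>_. 1) 0 x"
    by (simp add: G_transform_def generalized_diff_def)
  also have "\<dots> = (LINT s:{0<..<2*pi}|lebesgue. exp (\<i> * of_real s * x)) / (1 - exp (2 * pi * \<i> * x))"
    using generalized_diff_eq_period[OF x circle_integrable_kernel[OF circle_integrable_one], of 0]
    by simp
  also have "(LINT s:{0<..<2*pi}|lebesgue. exp (\<i> * of_real s * x))
      = (LINT s:{0..2*pi}|lebesgue. exp (\<i> * of_real s * x))"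
    by (rule set_integral_discrete_difference[where X="{0, 2*pi}"]) auto
  also have "\<dots> = integral {0..2*pi} (\<lambda>s. exp (\<i> * of_real s * x))"
    by (intro set_lebesgue_integral_eq_integral(2) absolutely_integrable_continuous_real continuous_intros)
  also have "\<dots> = exp (\<i> * of_real (2*pi) * x) / (\<i> * x) - exp (\<i> * of_real 0 * x) / (\<i> * x)"
  proof (intro integral_unique fundamental_theorem_of_calculus)
    fix s :: real
    have "((\<lambda>z. exp (\<i> * z * x) / (\<i> * x)) has_field_derivative exp (\<i> * of_real s * x)) (at (of_real s))"
      using x0 by (auto intro!: derivative_eq_intros)
    then show "((\<lambda>s. exp (\<i> * of_real s * x) / (\<i> * x)) has_vector_derivative exp (\<i> * of_real s * x))
        (at s within {0..2*pi})"
      by (rule has_vector_derivative_real_field)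
  qed simp
  also have "\<dots> / (1 - exp (2 * pi * \<i> * x)) = - (1 / (\<i> * x))"
  proof -
    have "\<i> * of_real (2*pi) * x = 2 * pi * \<i> * x" by simp
    then show ?thesis using E x0 by (simp add: field_simps)
  qed
  also have "\<dots> = \<i> / x"
    using x0 by (simp add: field_simps)
  finally show ?thesis .
qed

lemma add_of_nat_nonzero:
  assumes "Im x > 0"
  shows "x + of_nat k \<noteq> 0"
proof
  assume "x + of_nat k = 0"
  then have "Im (x + of_nat k) = 0" by simp
  with assms show False by simp
qed

lemma iterated_diff_inverse:
  assumes "Im x > 0"
    and G: "\<And>y. Im y > 0 \<Longrightarrow> G y = \<i> / y"
  shows "(forward_diff ^^ n) G x = \<i> * (-1) ^ n * fact n / pochhammer x (n + 1)"
  using assms(1)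
proof (induction n arbitrary: x)
  case 0
  then show ?case using G by simp
next
  case (Suc n)
  note nz = add_of_nat_nonzero[OF Suc.prems]
  \<comment> \<open>\<open>p\<close> is the common factor of the two denominators. With it the step
    becomes \<open>1 / (x + n + 1) - 1 / x = - (n + 1) / (x * (x + n + 1))\<close>.\<close>
  define p where "p = pochhammer (x + 1) n"
  have p: "p \<noteq> 0"
    using nz[of "Suc _"] by (auto simp: p_def pochhammer_eq_0_iff eq_neg_iff_add_eq_0 add_ac)
  have n1: "x + of_nat n + 1 \<noteq> 0" and x0: "x \<noteq> 0"
    using nz[of "Suc n"] nz[of 0] by (auto simp: add_ac)
  have 1: "pochhammer (x + 1) (n + 1) = p * (x + of_nat n + 1)"
    by (simp add: p_def pochhammer_rec' algebra_simps)
  have 2: "pochhammer x (n + 1) = x * p"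
    by (simp add: p_def pochhammer_rec)
  have 3: "pochhammer x (Suc n + 1) = x * p * (x + of_nat n + 1)"
    using 1 by (simp add: pochhammer_rec[of x "Suc n"])
  have "(forward_diff ^^ Suc n) G x
      = \<i> * (-1) ^ n * fact n / pochhammer (x + 1) (n + 1) - \<i> * (-1) ^ n * fact n / pochhammer x (n + 1)"
    using Suc.IH[of "x + 1"] Suc.IH[of x] Suc.prems by (simp add: forward_diff_funpow_Suc del: funpow.simps)
  also have "\<dots> = \<i> * (-1) ^ Suc n * fact (Suc n) / pochhammer x (Suc n + 1)"
    unfolding 1 2 3 using p n1 x0 by (simp add: divide_simps) (simp add: algebra_simps)
  finally show ?case .
qed

text \<open>An exact identity for every \<open>n\<close>, so the size of the prefactor never has to
  be estimated.\<close>

lemma generalized_diff_one: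
  assumes "Im x > 0"
  shows "(-1) ^ n * pochhammer x (n + 1) / (\<i> * fact n) * generalized_diff (\<lambda>_. 1) n x = 1"
proof -
  have "pochhammer x (n + 1) \<noteq> 0"
    using add_of_nat_nonzero[OF assms] by (auto simp: pochhammer_eq_0_iff eq_neg_iff_add_eq_0)
  then have "(-1) ^ n * pochhammer x (n + 1) / (\<i> * fact n)
      * (\<i> * (-1) ^ n * fact n / pochhammer x (n + 1)) = (-1) ^ n * (-1) ^ n"
    by simp
  also have "\<dots> = 1"
    by (simp flip: power_mult_distrib)
  finally show ?thesis
    using iterated_diff_inverse[OF assms G_transform_one]
      iterated_diff_G_transform[OF circle_integrable_one assms] by simp
qed

section \<open>The limit\<close>

lemma generalized_diff_limit:
  fixes F :: "complex \<Rightarrow> complex"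
  assumes t: "0 < t" "t < pi"
    and F: "continuous (at (cis t) within sphere 0 1) F"
    and int: "\<forall>\<^sub>F n in sequentially.
         set_integrable lebesgue {0<..<2*pi} (\<lambda>s. (cis s - 1) ^ n * F (cis s))"
  shows "(\<lambda>n. (-1) ^ n * pochhammer (node t n) (n + 1) / (\<i> * fact n)
                * generalized_diff F n (node t n)) \<longlonglongrightarrow> F (cis t)"
proof -
  define \<phi> where "\<phi> s = sin (s / 2) * exp (- (cot (t / 2) * s / 2))" for s
  have kernel: "exp (\<i> * of_real s * node t n) * (cis s - 1) ^ n * f
      = (2 * \<i>) ^ n * (of_real (\<phi> s ^ n) * f)" for s n f
    unfolding node_kernel \<phi>_def by (simp add: mult.assoc)
  have \<phi>_int: "\<forall>\<^sub>F n in sequentially.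
      set_integrable lebesgue {0<..<2*pi} (\<lambda>s. of_real (\<phi> s ^ n) * F (cis s))"
    using int
  proof eventually_elim
    case (elim n)
    have "set_integrable lebesgue {0..2*pi} (\<lambda>s. (cis s - 1) ^ n * F (cis s))
        \<longleftrightarrow> set_integrable lebesgue {0<..<2*pi} (\<lambda>s. (cis s - 1) ^ n * F (cis s))"
      by (rule set_integrable_discrete_difference[where X="{0, 2*pi}"]) auto
    \<comment> \<open>Dividing by \<open>(2 * \<i>) ^ n\<close> strips the constant from the kernel;
      the remaining multiplier is continuous on the closed period, hence preserves
      integrability.\<close>
    with elim have "set_integrable lebesgue {0<..<2*pi}
        (\<lambda>s. (exp (\<i> * of_real s * node t n) / (2 * \<i>) ^ n) * ((cis s - 1) ^ n * F (cis s)))"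
      by (intro set_integrable_mult_continuous continuous_intros) auto
    moreover have "(exp (\<i> * of_real s * node t n) / (2 * \<i>) ^ n) * ((cis s - 1) ^ n * F (cis s))
        = of_real (\<phi> s ^ n) * F (cis s)" for s
      using kernel[of s n "F (cis s)"] by (simp add: field_simps)
    ultimately show ?case by (simp only:)
  qed
  have lim: "(\<lambda>n. (LINT s:{0<..<2*pi}|lebesgue. complex_of_real (\<phi> s ^ n) * F (cis s))
      / complex_of_real (LINT s:{0<..<2*pi}|lebesgue. \<phi> s ^ n)) \<longlonglongrightarrow> F (cis t)"
  proof (rule power_weighted_average_tendsto[OF _ _ _ _ _ _ \<phi>_int])
    show "continuous_on {0..2*pi} \<phi>"
      unfolding \<phi>_def[abs_def] by (intro continuous_intros) auto
    show "0 \<le> \<phi> s" if "s \<in> {0..2*pi}" for s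
      using that by (auto simp: \<phi>_def intro!: mult_nonneg_nonneg sin_ge_zero)
    show "\<phi> s < \<phi> t" if "s \<in> {0..2*pi}" "s \<noteq> t" for s
      using sin_exp_less_max[OF t] that by (simp add: \<phi>_def)
    \<comment> \<open>Continuity along the circle suffices because \<open>cis\<close> maps the line
      into it.\<close>
    have "continuous (at t within UNIV) (F \<circ> cis)"
    proof (rule continuous_within_compose)
      have "continuous_on UNIV cis"
        by (intro continuous_intros)
      then show "continuous (at t) cis"
        by (simp add: continuous_on_eq_continuous_at)
      show "continuous (at (cis t) within range cis) F"
        by (rule continuous_within_subset[OF F]) auto
    qed
    then show "isCont (\<lambda>s. F (cis s)) t"
      by (simp add: o_def)
  qed (use t in auto)
  show ?thesis
  proof (rule Lim_transform_eventually[OF lim])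
    show "\<forall>\<^sub>F n in sequentially.
        (LINT s:{0<..<2*pi}|lebesgue. complex_of_real (\<phi> s ^ n) * F (cis s))
          / complex_of_real (LINT s:{0<..<2*pi}|lebesgue. \<phi> s ^ n)
        = (-1) ^ n * pochhammer (node t n) (n + 1) / (\<i> * fact n)
          * generalized_diff F n (node t n)"
      \<comment> \<open>\<open>n = 0\<close> is excluded because \<open>node t 0 = 0\<close> is not
        in the upper half-plane.\<close>
      using \<phi>_int eventually_gt_at_top[of 0]
    proof eventually_elim
      case (elim n)
      define C where "C = (-1) ^ n * pochhammer (node t n) (n + 1) / (\<i> * fact n)"
      \<comment> \<open>\<open>K\<close> does not depend on \<open>F\<close>. Comparison with the
        constant function gives \<open>C * K * D = 1\<close> for the mass \<open>D\<close>, so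
        multiplying by \<open>C * K\<close> is dividing by \<open>D\<close>.\<close>
      define K where "K = (2 * \<i>) ^ n / (1 - exp (2 * pi * \<i> * node t n))"
      have x: "Im (node t n) > 0"
        using Im_node_pos t elim by simp
      have "set_integrable lebesgue {0<..<2*pi}
          (\<lambda>s. exp (\<i> * of_real s * node t n) * (cis s - 1) ^ n * F (cis s))"
        unfolding kernel using elim by (intro set_integrable_mult_right)
      then have 1: "generalized_diff F n (node t n)
          = K * (LINT s:{0<..<2*pi}|lebesgue. of_real (\<phi> s ^ n) * F (cis s))"
        using generalized_diff_eq_period[OF x, of n F] unfolding kernel K_def by simp
      have 2: "generalized_diff (\<lambda>_. 1) n (node t n)
          = K * of_real (LINT s:{0<..<2*pi}|lebesgue. \<phi> s ^ n)"
        using generalized_diff_eq_period[OF x circle_integrable_kernel[OF circle_integrable_one], of n]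
        unfolding kernel K_def by (simp add: set_integral_complex_of_real[symmetric])
      have "C * (K * of_real (LINT s:{0<..<2*pi}|lebesgue. \<phi> s ^ n)) = 1"
        using generalized_diff_one[OF x, of n] unfolding 2 C_def .
      moreover have "I / D = C * (K * I)" if "C * (K * D) = 1" for I D :: complex
      proof -
        have "D \<noteq> 0" using that by auto
        then have "C * (K * I) = C * (K * D) * (I / D)" by simp
        with that show ?thesis by simp
      qed
      ultimately show ?case
        unfolding C_def[symmetric] 1 by blast
    qed
  qed
qed

theorem proposition2p4:
  fixes F :: "complex \<Rightarrow> complex"
  shows
    "(circle_integrable F \<longrightarrow>
       (\<forall>t. 0 < t \<and> t < pi \<and> continuous (at (cis t) within sphere 0 1) F \<longrightarrow>
         (\<lambda>n. (-1) ^ n * pochhammer (node t n) (n + 1) / (\<i> * fact n)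
                * (forward_diff ^^ n) (G_transform F) (node t n))
           \<longlonglongrightarrow> F (cis t)))
     \<and>
     ((\<forall>\<^sub>F n in sequentially.
         set_integrable lebesgue {0<..<2*pi} (\<lambda>s. (cis s - 1) ^ n * F (cis s))) \<longrightarrow>
       (\<forall>t. 0 < t \<and> t < pi \<and> continuous (at (cis t) within sphere 0 1) F \<longrightarrow>
         (\<lambda>n. (-1) ^ n * pochhammer (node t n) (n + 1) / (\<i> * fact n)
                * generalized_diff F n (node t n))
           \<longlonglongrightarrow> F (cis t)))"
proof (intro conjI impI allI; elim conjE)
  fix t :: real
  assume F: "circle_integrable F"
    and t: "0 < t" "t < pi" and cont: "continuous (at (cis t) within sphere 0 1) F"
  \<comment> \<open>At \<open>x = 0\<close> the exponential is 1, so the kernel lemma gives this for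
    every \<open>n\<close>.\<close>
  have "\<forall>\<^sub>F n in sequentially.
      set_integrable lebesgue {0<..<2*pi} (\<lambda>s. (cis s - 1) ^ n * F (cis s))"
    using circle_integrable_kernel[OF F, of 0] by simp
  from generalized_diff_limit[OF t cont this]
  show "(\<lambda>n. (-1) ^ n * pochhammer (node t n) (n + 1) / (\<i> * fact n)
      * (forward_diff ^^ n) (G_transform F) (node t n)) \<longlonglongrightarrow> F (cis t)"
  proof (rule Lim_transform_eventually)
    show "\<forall>\<^sub>F n in sequentially.
        (-1) ^ n * pochhammer (node t n) (n + 1) / (\<i> * fact n) * generalized_diff F n (node t n)
        = (-1) ^ n * pochhammer (node t n) (n + 1) / (\<i> * fact n)
          * (forward_diff ^^ n) (G_transform F) (node t n)"
      using eventually_gt_at_top[of 0]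
      by eventually_elim (simp add: iterated_diff_G_transform[OF F Im_node_pos[OF t]])
  qed
qed (rule generalized_diff_limit)

end
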